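(* Let $X_G$ be the shift space generated by a two-dimensional graph $G=(H,V)$, where neither adjacency matrix $H$ nor $V$ has a zero row or a zero column. If for all indices $i,j$ one has $(HV)_{ij}\neq 0 \iff (VH)_{ij}\neq 0$, then $X_G$ possesses periodic points of arbitrarily large periods, i.e. for every $R\in\mathbb{N}$ there exist a point $x\in X_G$ and a period $u$ of $x$ with $\|u\|\ge R$.
   Context: A two-dimensional graph is a pair $G=(H,V)$ of directed graphs (at most one edge for each ordered pair of vertices, loops allowed) on a common finite nonempty vertex set $\mathcal{V}$; $H$ and $V$ also denote their $0$-$1$ adjacency matrices indexed by $\mathcal{V}$. The shift space generated by $G$ is $$X_G=\{x\in\mathcal{V}^{\mathbb{Z}^2}: H_{x(i,j),x(i+1,j)}=1 \text{ and } V_{x(i,j),x(i,j+1)}=1 \text{ for all } (i,j)\in\mathbb{Z}^2\}.$$ A point $x$ is periodic if there is $u\in\mathbb{Z}^2\setminus\{0\}$ with $x(v+u)=x(v)$ for all $v\in\mathbb{Z}^2$; any such $u$ is called a period of $x$ (periods are not required to be minimal). $\|\cdot\|$ is the Euclidean norm. *)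

theory Defs
  imports "HOL-Analysis.Analysis"
begin

text \<open>The vertex set is the finite type \<open>'v\<close>. A directed graph on it with at most one edge for
  each ordered pair, loops allowed, is a set of ordered pairs; a two-dimensional graph is the pair
  of its horizontal and its vertical graph.\<close>

type_synonym 'v two_dim_graph = "'v rel \<times> 'v rel"

definition adjacency_matrix :: "('v::finite) rel \<Rightarrow> nat ^ 'v ^ 'v" where
  "adjacency_matrix E = (\<chi> a b. if (a, b) \<in> E then 1 else 0)"

definition shift_space :: "('v::finite) two_dim_graph \<Rightarrow> (int \<times> int \<Rightarrow> 'v) set" where
  "shift_space G = {x. \<forall>i j.
     adjacency_matrix (fst G) $ x (i, j) $ x (i + 1, j) = 1 \<and>
     adjacency_matrix (snd G) $ x (i, j) $ x (i, j + 1) = 1}"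

definition is_period :: "(int \<times> int \<Rightarrow> 'v) \<Rightarrow> int \<times> int \<Rightarrow> bool" where
  "is_period x u \<longleftrightarrow> u \<noteq> 0 \<and> (\<forall>v. x (v + u) = x v)"

text \<open>The norm on \<open>real \<times> real\<close> is the Euclidean one.\<close>

definition period_norm :: "int \<times> int \<Rightarrow> real" where
  "period_norm u = norm (real_of_int (fst u), real_of_int (snd u))"

end

theory Submission
  imports Defs
begin

text \<open>The lattice is swept out by the diagonals \<open>i \<mapsto> (i, i + n)\<close>, for \<open>n \<in> \<int>\<close>. If a point of the
  shift space has the values \<open>D\<close> along one diagonal and \<open>E\<close> along the diagonal above it, then the
  staircase between them reads \<open>D i\<close>, vertical edge, \<open>E i\<close>, horizontal edge, \<open>D (i + 1)\<close>, and so on;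
  conversely, a bi-infinite sequence of diagonals in which any two neighbours fit in this way is a
  point of the shift space.

  The support condition says that \<open>H\<close> and \<open>V\<close> commute as relations, so every corner of a staircase
  can be flipped to the other side. Flipping all lower corners of a staircase gives the next
  diagonal above it, flipping all upper corners the next diagonal below it (\<open>diagonal_above\<close>,
  \<open>diagonal_below\<close>).
  If the flips are chosen as a function of the two end points of a corner, then a staircase that
  is invariant under translation by \<open>(k, k)\<close> produces staircases with the same \<open>k\<close>: the period
  does not grow while the plane is being filled. It remains to find one periodic staircase, and
  this is a closed walk of the relation \<open>H O V\<close>, which exists because the relation is total on a
  finite set (\<open>total_relation_periodic_walk\<close>). Multiples of a period are periods.\<close>

lemma adjacency_matrix_mult_nonzero_iff:
  "(adjacency_matrix H ** adjacency_matrix V) $ a $ b \<noteq> 0 \<longleftrightarrow> (a, b) \<in> H O V"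
  by (auto simp: matrix_matrix_mult_def adjacency_matrix_def relcomp_unfold)

lemma adjacency_matrix_row_nonzero_iff:
  "row a (adjacency_matrix H) \<noteq> 0 \<longleftrightarrow> (\<exists>b. (a, b) \<in> H)"
  by (auto simp: row_def adjacency_matrix_def vec_eq_iff)

lemma shift_space_iff:
  "x \<in> shift_space (H, V) \<longleftrightarrow>
    (\<forall>i j. (x (i, j), x (i + 1, j)) \<in> H \<and> (x (i, j), x (i, j + 1)) \<in> V)"
  by (auto simp: shift_space_def adjacency_matrix_def)

lemma is_period_multiple:
  assumes "is_period x (k, l)" and "m > 0"
  shows "is_period x (int m * k, int m * l)"
proof -
  have per: "x (a + k, b + l) = x (a, b)" for a b
    using assms(1) by (auto simp: is_period_def)
  have "x (a + int n * k, b + int n * l) = x (a, b)" for n a b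
  proof (induction n)
    case (Suc n)
    then show ?case
      using per[of "a + int n * k" "b + int n * l"] by (simp add: algebra_simps)
  qed simp
  then show ?thesis
    using assms by (auto simp: is_period_def zero_prod_def)
qed

text \<open>Iterating a successor function from any starting vertex must repeat a value, and the part of
  the orbit between two equal values is a closed walk; it is unrolled over the integers.\<close>

lemma total_relation_periodic_walk:
  fixes r :: "('v::finite) rel"
  assumes "\<And>a. \<exists>b. (a, b) \<in> r"
  shows "\<exists>(D :: int \<Rightarrow> 'v) k. k > 0 \<and> (\<forall>i. (D i, D (i + 1)) \<in> r) \<and> (\<forall>i. D (i + k) = D i)"
proof -
  obtain s where s: "\<And>a. (a, s a) \<in> r"
    using assms by metis
  have "\<not> inj (\<lambda>n. (s ^^ n) undefined)"
    using finite_imageD[of "\<lambda>n. (s ^^ n) undefined" UNIV] by auto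
  then obtain m n :: nat where mn: "m < n" "(s ^^ m) undefined = (s ^^ n) undefined"
    by (metis (mono_tags, lifting) injI linorder_neqE_nat)
  define a where "a = (s ^^ m) undefined"
  define p where "p = n - m"
  have "p > 0"
    using mn by (simp add: p_def)
  have closed: "(s ^^ p) a = a"
    using mn unfolding a_def p_def
    by (metis comp_apply funpow_add le_add_diff_inverse2 less_imp_le)
  define D where "D i = (s ^^ nat (i mod int p)) a" for i
  have "D (i + 1) = s (D i)" for i
  proof -
    have "(i + 1) mod int p = int (Suc (nat (i mod int p)) mod p)"
      using \<open>p > 0\<close> by (simp add: zmod_int mod_add_right_eq add.commute)
    then have "D (i + 1) = (s ^^ (Suc (nat (i mod int p)) mod p)) a"
      by (simp add: D_def)
    also have "\<dots> = (s ^^ Suc (nat (i mod int p))) a"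
      by (rule funpow_mod_eq[OF closed])
    finally show ?thesis
      by (simp add: D_def)
  qed
  then have "\<forall>i. (D i, D (i + 1)) \<in> r"
    using s by simp
  moreover have "\<forall>i. D (i + int p) = D i"
    by (simp add: D_def)
  moreover have "int p > 0"
    using \<open>p > 0\<close> by simp
  ultimately show ?thesis
    by blast
qed

text \<open>Dependent choice over the integers: the two one-sided choices are glued at the starting
  point, which both halves share.\<close>

lemma dependent_int_choice:
  assumes "P d"
    and up: "\<And>x. P x \<Longrightarrow> \<exists>y. P y \<and> R x y"
    and down: "\<And>x. P x \<Longrightarrow> \<exists>y. P y \<and> R y x"
  shows "\<exists>f :: int \<Rightarrow> 'a. \<forall>n. P (f n) \<and> R (f n) (f (n + 1))"
proof -
  obtain u l where u: "\<And>x. P x \<Longrightarrow> P (u x) \<and> R x (u x)"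
    and l: "\<And>x. P x \<Longrightarrow> P (l x) \<and> R (l x) x"
    using up down by metis
  have Pu: "P ((u ^^ n) d)" and Pl: "P ((l ^^ n) d)" for n
    by (induction n) (use u l \<open>P d\<close> in auto)
  define f where "f n = (if n \<ge> 0 then (u ^^ nat n) d else (l ^^ nat (- n)) d)" for n
  have "R (f n) (f (n + 1))" for n
  proof (cases "n \<ge> 0")
    case True
    then have "f (n + 1) = u (f n)"
      by (simp add: f_def nat_add_distrib)
    then show ?thesis
      using u Pu True by (simp add: f_def)
  next
    case False
    then obtain m where m: "n = - int (Suc m)"
      by (metis int_cases not_le of_nat_0_le_iff)
    have "f (n + 1) = (l ^^ m) d"
      by (cases m) (simp_all add: f_def m nat_add_distrib)
    moreover have "f n = l ((l ^^ m) d)"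
      by (simp add: f_def m nat_add_distrib)
    ultimately show ?thesis
      using l Pl by simp
  qed
  moreover have "P (f n)" for n
    using Pu Pl by (simp add: f_def)
  ultimately show ?thesis
    by blast
qed

text \<open>The possible values of a point along a diagonal, when it is invariant under \<open>(k, k)\<close>.\<close>

definition periodic_diagonal :: "'v rel \<Rightarrow> 'v rel \<Rightarrow> int \<Rightarrow> (int \<Rightarrow> 'v) \<Rightarrow> bool" where
  "periodic_diagonal H V k D \<longleftrightarrow> (\<forall>i. (D i, D (i + 1)) \<in> H O V) \<and> (\<forall>i. D (i + k) = D i)"

definition staircase :: "'v rel \<Rightarrow> 'v rel \<Rightarrow> (int \<Rightarrow> 'v) \<Rightarrow> (int \<Rightarrow> 'v) \<Rightarrow> bool" where
  "staircase H V D E \<longleftrightarrow> (\<forall>i. (D i, E i) \<in> V \<and> (E i, D (i + 1)) \<in> H)"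

text \<open>The corner values depend on the two neighbours on the diagonal only, hence inherit their
  period; consecutive new values are joined by a horizontal and then a vertical edge through the
  old diagonal.\<close>

lemma diagonal_above:
  assumes comm: "H O V = V O H" and D: "periodic_diagonal H V k D"
  shows "\<exists>E. periodic_diagonal H V k E \<and> staircase H V D E"
proof -
  have "\<exists>c. (a, c) \<in> V \<and> (c, b) \<in> H" if "(a, b) \<in> H O V" for a b
    using that comm by auto
  then obtain f where f: "\<And>a b. (a, b) \<in> H O V \<Longrightarrow> (a, f a b) \<in> V \<and> (f a b, b) \<in> H"
    by metis
  define E where "E i = f (D i) (D (i + 1))" for i
  have DHV: "(D i, D (i + 1)) \<in> H O V" and Dk: "D (i + k) = D i" for i
    using D by (auto simp: periodic_diagonal_def)
  have st: "staircase H V D E"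
    using f[OF DHV] by (simp add: staircase_def E_def)
  have "E (i + k) = E i" for i
    using Dk[of i] Dk[of "i + 1"] by (simp add: E_def algebra_simps)
  then have "periodic_diagonal H V k E"
    using st unfolding periodic_diagonal_def staircase_def by blast
  then show ?thesis
    using st by blast
qed

text \<open>The vertex below \<open>D i\<close> completes the corner from \<open>D (i - 1)\<close> to \<open>D i\<close>, whence the shift
  in the index.\<close>

lemma diagonal_below:
  assumes comm: "H O V = V O H" and D: "periodic_diagonal H V k D"
  shows "\<exists>E. periodic_diagonal H V k E \<and> staircase H V E D"
proof -
  have "\<exists>c. (a, c) \<in> H \<and> (c, b) \<in> V" if "(a, b) \<in> H O V" for a b
    using that by auto
  then obtain g where g: "\<And>a b. (a, b) \<in> H O V \<Longrightarrow> (a, g a b) \<in> H \<and> (g a b, b) \<in> V"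
    by metis
  define E where "E i = g (D (i - 1)) (D i)" for i
  have DHV: "(D i, D (i + 1)) \<in> H O V" and Dk: "D (i + k) = D i" for i
    using D by (auto simp: periodic_diagonal_def)
  have st: "staircase H V E D"
    unfolding staircase_def
  proof (intro allI conjI)
    fix i
    show "(E i, D i) \<in> V"
      using g[OF DHV[of "i - 1"]] by (simp add: E_def)
    show "(D i, E (i + 1)) \<in> H"
      using g[OF DHV[of i]] by (simp add: E_def)
  qed
  have "E (i + k) = E i" for i
    using Dk[of "i - 1"] Dk[of i] by (simp add: E_def algebra_simps)
  moreover have "(E i, E (i + 1)) \<in> H O V" for i
    using st unfolding comm staircase_def by blast
  ultimately show ?thesis
    using st unfolding periodic_diagonal_def by blast
qed

lemma periodic_point_exists:
  fixes H V :: "('v::finite) rel"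
  assumes H: "\<And>a. \<exists>b. (a, b) \<in> H" and V: "\<And>a. \<exists>b. (a, b) \<in> V"
    and comm: "H O V = V O H"
  obtains x k where "k > 0" and "x \<in> shift_space (H, V)" and "is_period x (k, k)"
proof -
  have "\<And>a. \<exists>b. (a, b) \<in> H O V"
    using H V by blast
  then obtain D0 k where "k > 0" and "periodic_diagonal H V k D0"
    using total_relation_periodic_walk[of "H O V"] unfolding periodic_diagonal_def by auto
  then obtain D :: "int \<Rightarrow> int \<Rightarrow> 'v" where
    "\<forall>n. periodic_diagonal H V k (D n) \<and> staircase H V (D n) (D (n + 1))"
    using dependent_int_choice[of "periodic_diagonal H V k" D0 "staircase H V"]
      diagonal_above[OF comm] diagonal_below[OF comm] by auto
  then have D: "periodic_diagonal H V k (D n)" and st: "staircase H V (D n) (D (n + 1))" for n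
    by auto
  define x where "x = (\<lambda>(i, j). D (j - i) i)"
  have "(x (i, j), x (i + 1, j)) \<in> H \<and> (x (i, j), x (i, j + 1)) \<in> V" for i j
    using st[of "j - i"] st[of "j - i - 1"]
    by (auto simp: x_def staircase_def algebra_simps)
  then have "x \<in> shift_space (H, V)"
    by (simp add: shift_space_iff)
  moreover have "is_period x (k, k)"
    using D \<open>k > 0\<close> by (auto simp: is_period_def x_def periodic_diagonal_def zero_prod_def)
  ultimately show thesis
    using that \<open>k > 0\<close> by blast
qed

theorem proposition7:
  fixes H V :: "('v::finite) rel"
  assumes "\<And>i. row i (adjacency_matrix H) \<noteq> 0"
    and "\<And>j. column j (adjacency_matrix H) \<noteq> 0"
    and "\<And>i. row i (adjacency_matrix V) \<noteq> 0"
    and "\<And>j. column j (adjacency_matrix V) \<noteq> 0"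
    and "\<And>i j. (adjacency_matrix H ** adjacency_matrix V) $ i $ j \<noteq> 0 \<longleftrightarrow>
               (adjacency_matrix V ** adjacency_matrix H) $ i $ j \<noteq> 0"
  shows "\<forall>R::nat. \<exists>x\<in>shift_space (H, V). \<exists>u. is_period x u \<and> period_norm u \<ge> real R"
proof
  fix R :: nat
  have "H O V = V O H"
    using assms(5) unfolding adjacency_matrix_mult_nonzero_iff by auto
  then obtain x k where k: "k > 0" and x: "x \<in> shift_space (H, V)" and per: "is_period x (k, k)"
    using periodic_point_exists[of H V] assms(1,3)
    unfolding adjacency_matrix_row_nonzero_iff by metis
  \<comment> \<open>The factor is \<open>Suc R\<close> because for \<open>R = 0\<close> the multiple must still be nonzero.\<close>
  define l where "l = int (Suc R) * k"
  have "is_period x (l, l)"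
    unfolding l_def by (rule is_period_multiple[OF per]) simp
  moreover have "period_norm (l, l) \<ge> real R"
  proof -
    have "int (Suc R) * 1 \<le> l"
      unfolding l_def using k by (intro mult_left_mono) auto
    then have "real_of_int (int R) \<le> real_of_int l"
      by (subst of_int_le_iff) simp
    then have "real R \<le> norm (real_of_int l)"
      by simp
    also have "\<dots> \<le> period_norm (l, l)"
      using norm_fst_le[of "real_of_int l" "real_of_int l"] by (simp add: period_norm_def)
    finally show ?thesis .
  qed
  ultimately show "\<exists>x\<in>shift_space (H, V). \<exists>u. is_period x u \<and> period_norm u \<ge> real R"
    using x by blast
qed

end
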